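(* Let $n>3$ be an odd integer, let $G=\mathbb{Z}_n\times\mathbb{Z}_3$, and let $<$ be any total ordering on $\mathbb{Z}_n$. Define \begin{align*} \mathcal{B}=&\left\{\{(a,i),(b,i),(\tfrac{n+1}{2}(a+b),i+1)\}\;\middle|\; i\in\mathbb{Z}_3,\ a,b\in\mathbb{Z}_n,\ a<b\right\}\\ &\cup\left\{\{(a,i),(b-1,i),(\tfrac{n+1}{2}(a+b),i+1)\}\;\middle|\; i\in\mathbb{Z}_3,\ a,b\in\mathbb{Z}_n,\ a\not<b,\ a\neq b-1\right\}\\ &\cup\left\{\{(a,0),(a,1),(a,2)\}\;\middle|\; a\in\mathbb{Z}_n\right\}. \end{align*} Then $(G,\mathcal{B})$ is a $2$-$(3n,3,1)$ adesign (with $3n^2-2n$ blocks).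
   Context: Here $\frac{n+1}{2}(a+b)$ denotes the element of $\mathbb{Z}_n$ obtained by multiplying $a+b$ by the integer $\frac{n+1}{2}$, and $i+1$ is computed in $\mathbb{Z}_3$. A $2$-$(v,k,\lambda)$ adesign is an incidence structure (a point set $V$ with $|V|=v$ and a collection of $k$-subsets of $V$ called blocks) in which every pair of distinct points lies in either $\lambda$ or $\lambda+1$ blocks for a positive integer $\lambda$, and which is not a $2$-design (i.e., not every pair lies in the same number of blocks).
   Formalization: The count 3n²−2n fails for some total orderings (e.g. n=5, 0<3<2<1<4); it is proved exactly when each pair {x,y}, x≠y, has x≮y+1 or y≮x+1, and so for the usual order. The adesign claim is proved for all total orderings. *)

theory Defs
  imports Main
begin

text \<open>An incidence structure is given by its point set \<open>V\<close> and its set \<open>\<B>\<close> of blocks; there are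
  no repeated blocks.\<close>

definition incidence_structure :: "'a set \<Rightarrow> 'a set set \<Rightarrow> nat \<Rightarrow> nat \<Rightarrow> bool" where
  "incidence_structure V \<B> v k \<longleftrightarrow>
     finite V \<and> card V = v \<and> (\<forall>A\<in>\<B>. A \<subseteq> V \<and> card A = k)"

definition pair_index :: "'a set set \<Rightarrow> 'a \<Rightarrow> 'a \<Rightarrow> nat" where
  "pair_index \<B> x y = card {A \<in> \<B>. x \<in> A \<and> y \<in> A}"

definition two_design :: "'a set \<Rightarrow> 'a set set \<Rightarrow> nat \<Rightarrow> nat \<Rightarrow> nat \<Rightarrow> bool" where
  "two_design V \<B> v k \<mu> \<longleftrightarrow>
     incidence_structure V \<B> v k \<and> (\<forall>x\<in>V. \<forall>y\<in>V. x \<noteq> y \<longrightarrow> pair_index \<B> x y = \<mu>)"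

definition two_adesign :: "'a set \<Rightarrow> 'a set set \<Rightarrow> nat \<Rightarrow> nat \<Rightarrow> nat \<Rightarrow> bool" where
  "two_adesign V \<B> v k l \<longleftrightarrow>
     incidence_structure V \<B> v k \<and> l > 0 \<and>
     (\<forall>x\<in>V. \<forall>y\<in>V. x \<noteq> y \<longrightarrow> pair_index \<B> x y \<in> {l, l + 1}) \<and>
     \<not> (\<exists>\<mu>. two_design V \<B> v k \<mu>)"

text \<open>\<open>\<int>\<^sub>n\<close> is represented by the residues \<open>0, \<dots>, n - 1\<close>; arithmetic is integer arithmetic
  followed by reduction modulo \<open>n\<close>.\<close>

definition Zn :: "nat \<Rightarrow> int set" where
  "Zn n = {0..<int n}"

definition strict_total_order_on :: "'a set \<Rightarrow> ('a \<Rightarrow> 'a \<Rightarrow> bool) \<Rightarrow> bool" where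
  "strict_total_order_on A lt \<longleftrightarrow> irreflp_on A lt \<and> transp_on A lt \<and> totalp_on A lt"

definition blocks :: "nat \<Rightarrow> (int \<Rightarrow> int \<Rightarrow> bool) \<Rightarrow> (int \<times> int) set set" where
  "blocks n lt =
     {{(a, i), (b, i), (((int n + 1) div 2 * (a + b)) mod int n, (i + 1) mod 3)} | i a b.
        i \<in> Zn 3 \<and> a \<in> Zn n \<and> b \<in> Zn n \<and> lt a b}
   \<union> {{(a, i), ((b - 1) mod int n, i),
        (((int n + 1) div 2 * (a + b)) mod int n, (i + 1) mod 3)} | i a b.
        i \<in> Zn 3 \<and> a \<in> Zn n \<and> b \<in> Zn n \<and> \<not> lt a b \<and> a \<noteq> (b - 1) mod int n}
   \<union> {{(a, 0), (a, 1), (a, 2)} | a. a \<in> Zn n}"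

text \<open>An unordered pair \<open>{x, y}\<close> of distinct residues occurs in the second family of blocks (as
  \<open>{a, b - 1}\<close>, at each level \<open>i\<close>) iff \<open>(x, y + 1)\<close> or \<open>(y, x + 1)\<close> is a pair \<open>(a, b)\<close> with
  \<open>\<not> lt a b\<close>. The following condition says that no pair \<open>{x, y}\<close> is left out; not every total
  order on \<open>\<int>\<^sub>n\<close> satisfies it, but the usual order of \<open>0, \<dots>, n - 1\<close> does.\<close>

definition no_pair_omitted :: "nat \<Rightarrow> (int \<Rightarrow> int \<Rightarrow> bool) \<Rightarrow> bool" where
  "no_pair_omitted n lt \<longleftrightarrow>
     (\<forall>x\<in>Zn n. \<forall>y\<in>Zn n. x \<noteq> y \<longrightarrow>
        \<not> lt x ((y + 1) mod int n) \<or> \<not> lt y ((x + 1) mod int n))"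

end

theory Submission
  imports Defs "HOL-Number_Theory.Cong"
begin

text \<open>Since \<open>n\<close> is odd, \<open>(n + 1) / 2\<close> is the inverse of \<open>2\<close> in \<open>\<int>\<^sub>n\<close>. With \<open>c = b - 1\<close>, the blocks of
  the second family are \<open>{(a, i), (c, i), ((a + c + 1) / 2, i + 1)}\<close>, so apart from the columns
  \<open>{(a, 0), (a, 1), (a, 2)}\<close> every block is given by a level \<open>i\<close>, a shift \<open>e \<in> {0, 1}\<close> and a
  2-subset \<open>P\<close> of \<open>\<int>\<^sub>n\<close>, and these data can be recovered from the block. All 2-subsets occur for
  \<open>e = 0\<close>, but possibly not all for \<open>e = 1\<close>.

  Two points on the level \<open>i\<close> determine \<open>P\<close>, and \<open>(x, i)\<close>, \<open>(y, i + 1)\<close> with the shift \<open>e\<close> determine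
  \<open>P = {x, 2y - x - e}\<close>. So each shift contributes at most one block to a pair, and the shift \<open>0\<close>
  contributes one unless \<open>x = y\<close>; in that case the column and the shift \<open>1\<close>, with \<open>P = {x, x - 1}\<close>,
  contribute one each. For \<open>2 (y - x) = 1\<close> only the shift \<open>0\<close> contributes, so both indices \<open>1\<close>
  and \<open>2\<close> occur.\<close>

section \<open>Blocks encoded by a level, a shift and a 2-subset\<close>

definition half :: "nat \<Rightarrow> int \<Rightarrow> int" where
  "half n s = ((int n + 1) div 2 * s) mod int n"

text \<open>Taking \<open>\<Sum>P\<close> lets the block depend on the unordered pair only, so that
  no ordering of \<open>P\<close> has to be chosen.\<close>

definition level_block :: "nat \<Rightarrow> int \<Rightarrow> int \<Rightarrow> int set \<Rightarrow> (int \<times> int) set" where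
  "level_block n i e P = insert (half n (\<Sum>P + e), (i + 1) mod 3) (P \<times> {i})"

definition column :: "int \<Rightarrow> (int \<times> int) set" where
  "column a = {(a, 0), (a, 1), (a, 2)}"

definition two_subsets :: "'a set \<Rightarrow> 'a set set" where
  "two_subsets A = {P. P \<subseteq> A \<and> card P = 2}"

text \<open>The element \<open>y\<close> plays the role of \<open>b - 1\<close>, so
  \<open>(y + 1) mod int n\<close> is \<open>b\<close>. An unordered pair qualifies as soon as one
  of its two orientations does.\<close>

definition shifted_pairs :: "nat \<Rightarrow> (int \<Rightarrow> int \<Rightarrow> bool) \<Rightarrow> int set set" where
  "shifted_pairs n lt =
     {{x, y} | x y. x \<in> Zn n \<and> y \<in> Zn n \<and> x \<noteq> y \<and> \<not> lt x ((y + 1) mod int n)}"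

definition labels :: "nat \<Rightarrow> (int \<Rightarrow> int \<Rightarrow> bool) \<Rightarrow> (int \<times> int set) set" where
  "labels n lt = {0} \<times> two_subsets (Zn n) \<union> {1} \<times> shifted_pairs n lt"

section \<open>Halving modulo an odd number\<close>

lemma two_half_cong:
  assumes "odd n"
  shows "[2 * half n s = s] (mod int n)"
proof -
  obtain k where k: "int n = 2 * k + 1"
    using assms by (metis even_of_nat oddE)
  have "[2 * half n s = 2 * ((k + 1) * s)] (mod int n)"
    unfolding half_def k by (simp add: cong_def mod_mult_right_eq add.commute)
  also have "2 * ((k + 1) * s) = s + int n * s"
    by (simp add: k algebra_simps)
  also have "[s + int n * s = s] (mod int n)"
    by (simp add: cong_def)
  finally show ?thesis .
qed

lemma half_cong: "[s = t] (mod int n) \<Longrightarrow> half n s = half n t"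
  unfolding half_def cong_def by (metis mod_mult_right_eq)

lemma half_eq_iff: "odd n \<Longrightarrow> half n s = half n t \<longleftrightarrow> [s = t] (mod int n)"
  by (metis half_cong two_half_cong cong_sym cong_trans)

lemma Zn_eq_iff: "x \<in> Zn n \<Longrightarrow> y \<in> Zn n \<Longrightarrow> x = y \<longleftrightarrow> [x = y] (mod int n)"
  by (auto simp: Zn_def cong_def)

lemma mod_in_Zn: "n > 0 \<Longrightarrow> s mod int n \<in> Zn n"
  by (simp add: Zn_def)

lemma half_in_Zn: "n > 0 \<Longrightarrow> half n s \<in> Zn n"
  by (simp add: half_def mod_in_Zn)

text \<open>Since 2 is cancellable modulo an odd \<open>n\<close>, a condition on a midpoint becomes
  a linear congruence, which can be solved for an element of the pair.\<close>

lemma half_eq_Zn_iff: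
  assumes "odd n" and "x \<in> Zn n"
  shows "half n s = x \<longleftrightarrow> [s = 2 * x] (mod int n)"
proof -
  have "half n (2 * x) = x"
  proof -
    have "n > 0" using assms(1) by (rule odd_pos)
    moreover have "coprime 2 (int n)" using assms(1) by simp
    ultimately show ?thesis
      using two_half_cong[OF assms(1), of "2 * x"] Zn_eq_iff[OF half_in_Zn assms(2)]
      by (simp add: cong_mult_lcancel)
  qed
  then show ?thesis
    using half_eq_iff[OF assms(1), of s "2 * x"] by simp
qed

section \<open>Residues and their 2-subsets\<close>

lemma Zn_3: "Zn 3 = {0, 1, 2}"
  by (auto simp: Zn_def)

lemma card_Zn: "card (Zn n) = n"
  by (simp add: Zn_def)

lemma finite_Zn: "finite (Zn n)"
  by (simp add: Zn_def)

lemma two_subsetsE: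
  assumes "P \<in> two_subsets A"
  obtains x y where "P = {x, y}" "x \<in> A" "y \<in> A" "x \<noteq> y"
  using assms by (auto simp: two_subsets_def card_2_iff)

lemma two_subsetsI: "x \<in> A \<Longrightarrow> y \<in> A \<Longrightarrow> x \<noteq> y \<Longrightarrow> {x, y} \<in> two_subsets A"
  by (simp add: two_subsets_def)

lemma finite_two_subsets: "finite A \<Longrightarrow> finite (two_subsets A)"
  by (simp add: two_subsets_def)

lemma two_subsets_doubleton_eq:
  "P \<in> two_subsets A \<Longrightarrow> x \<in> P \<Longrightarrow> y \<in> P \<Longrightarrow> x \<noteq> y \<Longrightarrow> P = {x, y}"
  by (auto simp: two_subsets_def card_2_iff)

lemma shifted_pairs_subset: "shifted_pairs n lt \<subseteq> two_subsets (Zn n)"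
  by (auto simp: shifted_pairs_def intro!: two_subsetsI)

text \<open>A 2-subset is missing from \<open>shifted_pairs\<close> exactly when both of its
  orientations are excluded, and \<open>no_pair_omitted\<close> forbids just that.\<close>

lemma shifted_pairs_eq_iff:
  "shifted_pairs n lt = two_subsets (Zn n) \<longleftrightarrow> no_pair_omitted n lt"
proof -
  have "{x, y} \<in> shifted_pairs n lt \<longleftrightarrow>
      \<not> lt x ((y + 1) mod int n) \<or> \<not> lt y ((x + 1) mod int n)"
    if "x \<in> Zn n" "y \<in> Zn n" "x \<noteq> y" for x y
    using that unfolding shifted_pairs_def by (auto simp: doubleton_eq_iff)
  then have "two_subsets (Zn n) \<subseteq> shifted_pairs n lt \<longleftrightarrow> no_pair_omitted n lt"
    unfolding no_pair_omitted_def by (auto elim!: two_subsetsE intro: two_subsetsI)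
  then show ?thesis
    using shifted_pairs_subset[of n lt] by blast
qed

lemma labels_cases:
  assumes "(e, P) \<in> labels n lt"
  shows "e \<in> {0, 1}" and "P \<in> two_subsets (Zn n)"
  using assms shifted_pairs_subset[of n lt] by (auto simp: labels_def)

section \<open>Blocks and the data that determine them\<close>

lemma mem_level_block:
  "(x, j) \<in> level_block n i e P \<longleftrightarrow>
     j = i \<and> x \<in> P \<or> j = (i + 1) mod 3 \<and> x = half n (\<Sum>P + e)"
  by (auto simp: level_block_def)

text \<open>The level that carries two points is \<open>i\<close>, and these points form
  \<open>P\<close>. The remaining point determines \<open>\<Sum>P + e\<close> modulo
  \<open>n\<close>, hence \<open>e\<close>, because 0 and 1 are incongruent for
  \<open>n > 1\<close>.\<close>

lemma level_block_inject:
  assumes "odd n" "n > 1" and ij: "i \<in> Zn 3" "j \<in> Zn 3"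
    and P: "P \<in> two_subsets (Zn n)" and Q: "Q \<in> two_subsets (Zn n)"
    and e: "e \<in> {0, 1}" "f \<in> {0, 1}"
    and eq: "level_block n i e P = level_block n j f Q"
  shows "i = j \<and> e = f \<and> P = Q"
proof -
  obtain x y where xy: "P = {x, y}" "x \<noteq> y" using P by (rule two_subsetsE)
  have iff: "l = i \<and> z \<in> P \<or> l = (i + 1) mod 3 \<and> z = half n (\<Sum>P + e) \<longleftrightarrow>
      l = j \<and> z \<in> Q \<or> l = (j + 1) mod 3 \<and> z = half n (\<Sum>Q + f)" for z l
    using eq unfolding mem_level_block[symmetric] by simp
  have succ: "(i + 1) mod 3 \<noteq> i" "(j + 1) mod 3 \<noteq> j"
    using ij by (auto simp: Zn_3)
  \<comment> \<open>Otherwise the distinct points \<open>(x, i)\<close> and \<open>(y, i)\<close>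
    would both equal the single point that the second block has outside its level
    \<open>j\<close>.\<close>
  have "i = j"
    using iff[of i x] iff[of i y] xy by auto
  moreover have "P = Q"
    using iff[of i] succ \<open>i = j\<close> by auto
  moreover have "half n (\<Sum>P + e) = half n (\<Sum>Q + f)"
    using iff[of "(i + 1) mod 3" "half n (\<Sum>P + e)"] succ \<open>i = j\<close> by auto
  then have "[e = f] (mod int n)"
    using assms(1) \<open>P = Q\<close> by (simp add: half_eq_iff cong_add_lcancel)
  then have "e = f"
    using e \<open>n > 1\<close> by (auto simp: cong_def)
  ultimately show ?thesis by simp
qed

text \<open>A column meets all three levels, whereas a level block misses level
  \<open>i + 2\<close>.\<close>

lemma column_neq_level_block:
  assumes "i \<in> Zn 3"
  shows "column a \<noteq> level_block n i e P"
proof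
  assume eq: "column a = level_block n i e P"
  have "(a, (i + 2) mod 3) \<in> column a"
    using assms by (auto simp: Zn_3 column_def)
  then have "(a, (i + 2) mod 3) \<in> level_block n i e P"
    unfolding eq .
  then show False
    using assms by (auto simp: mem_level_block Zn_3)
qed

text \<open>In the first family, irreflexivity makes \<open>a\<close> and \<open>b\<close> distinct,
  and totality orients every 2-subset in some way. The second family is reparametrized by the
  bijection between \<open>b\<close> and \<open>b - 1\<close> on the residues.\<close>

lemma blocks_eq:
  assumes "n > 1" and order: "strict_total_order_on (Zn n) lt"
  shows "blocks n lt =
    (\<lambda>(i, e, P). level_block n i e P) ` (Zn 3 \<times> labels n lt) \<union> column ` Zn n"
proof -
  have 1: "{{(a, i), (b, i), (((int n + 1) div 2 * (a + b)) mod int n, (i + 1) mod 3)} | i a b.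
        i \<in> Zn 3 \<and> a \<in> Zn n \<and> b \<in> Zn n \<and> lt a b}
      = (\<lambda>(i, P). level_block n i 0 P) ` (Zn 3 \<times> two_subsets (Zn n))" (is "?L = ?R")
  proof
    show "?L \<subseteq> ?R"
    proof
      fix A assume "A \<in> ?L"
      then obtain i a b where *: "i \<in> Zn 3" "a \<in> Zn n" "b \<in> Zn n" "lt a b"
        and A: "A = {(a, i), (b, i), (((int n + 1) div 2 * (a + b)) mod int n, (i + 1) mod 3)}"
        by blast
      have "a \<noteq> b"
        using * order by (auto simp: strict_total_order_on_def irreflp_on_def)
      then have "A = level_block n i 0 {a, b}"
        unfolding A level_block_def half_def by auto
      then show "A \<in> ?R"
        using * two_subsetsI[OF *(2,3) \<open>a \<noteq> b\<close>] by (auto intro!: image_eqI[of _ _ "(i, {a, b})"])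
    qed
    show "?R \<subseteq> ?L"
    proof
      fix A assume "A \<in> ?R"
      then obtain i P where i: "i \<in> Zn 3" and P: "P \<in> two_subsets (Zn n)"
        and A: "A = level_block n i 0 P"
        by auto
      obtain x y where xy: "P = {x, y}" "x \<in> Zn n" "y \<in> Zn n" "x \<noteq> y"
        using P by (rule two_subsetsE)
      have "lt x y \<or> lt y x"
        using xy order by (auto simp: strict_total_order_on_def totalp_on_def)
      then obtain a b where ab: "P = {a, b}" "a \<in> Zn n" "b \<in> Zn n" "a \<noteq> b" "lt a b"
        using xy by (metis insert_commute)
      then have "level_block n i 0 P =
          {(a, i), (b, i), (((int n + 1) div 2 * (a + b)) mod int n, (i + 1) mod 3)}"
        unfolding level_block_def half_def by auto
      then show "A \<in> ?L"
        unfolding A using ab i by blast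
    qed
  qed
  have 2: "{{(a, i), ((b - 1) mod int n, i),
        (((int n + 1) div 2 * (a + b)) mod int n, (i + 1) mod 3)} | i a b.
        i \<in> Zn 3 \<and> a \<in> Zn n \<and> b \<in> Zn n \<and> \<not> lt a b \<and> a \<noteq> (b - 1) mod int n}
      = (\<lambda>(i, P). level_block n i 1 P) ` (Zn 3 \<times> shifted_pairs n lt)" (is "?L = ?R")
  proof
    show "?L \<subseteq> ?R"
    proof
      fix A assume "A \<in> ?L"
      then obtain i a b where *: "i \<in> Zn 3" "a \<in> Zn n" "b \<in> Zn n" "\<not> lt a b"
          "a \<noteq> (b - 1) mod int n"
        and A: "A = {(a, i), ((b - 1) mod int n, i),
          (((int n + 1) div 2 * (a + b)) mod int n, (i + 1) mod 3)}"
        by blast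
      define c where "c = (b - 1) mod int n"
      have c: "c \<in> Zn n" "a \<noteq> c" "(c + 1) mod int n = b"
        using * \<open>n > 1\<close> by (auto simp: c_def mod_in_Zn mod_add_left_eq Zn_def)
      \<comment> \<open>The reduction of \<open>b - 1\<close> modulo \<open>n\<close> may wrap
        around, but \<open>half\<close> depends on its argument only modulo
        \<open>n\<close>.\<close>
      have "half n (a + c + 1) = half n (a + b)"
        using c(3) by (intro half_cong) (metis add.assoc cong_def mod_add_right_eq)
      then have "A = level_block n i 1 {a, c}"
        unfolding A level_block_def half_def c_def[symmetric] using c by (auto simp: add.assoc)
      moreover have "{a, c} \<in> shifted_pairs n lt"
        unfolding shifted_pairs_def using * c by blast
      ultimately show "A \<in> ?R"
        using *(1) by (auto intro!: image_eqI[of _ _ "(i, {a, c})"])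
    qed
    show "?R \<subseteq> ?L"
    proof
      fix A assume "A \<in> ?R"
      then obtain i P where i: "i \<in> Zn 3" and P: "P \<in> shifted_pairs n lt"
        and A: "A = level_block n i 1 P"
        by auto
      obtain x y where xy: "P = {x, y}" "x \<in> Zn n" "y \<in> Zn n" "x \<noteq> y"
          "\<not> lt x ((y + 1) mod int n)"
        using P unfolding shifted_pairs_def by blast
      define b where "b = (y + 1) mod int n"
      have b: "b \<in> Zn n" "(b - 1) mod int n = y"
        using xy \<open>n > 1\<close> by (auto simp: b_def mod_in_Zn mod_diff_left_eq Zn_def)
      have "half n (x + y + 1) = half n (x + b)"
        unfolding b_def by (intro half_cong) (simp add: cong_def mod_add_right_eq add.assoc)
      then have "level_block n i 1 P = {(x, i), ((b - 1) mod int n, i),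
          (((int n + 1) div 2 * (x + b)) mod int n, (i + 1) mod 3)}"
        unfolding level_block_def half_def b using xy by (auto simp: add.assoc)
      moreover have "\<not> lt x b" "x \<noteq> (b - 1) mod int n"
        using xy b by (auto simp: b_def)
      ultimately show "A \<in> ?L"
        unfolding A using xy i b(1) by blast
    qed
  qed
  have "(\<lambda>(i, e, P). level_block n i e P) ` (Zn 3 \<times> labels n lt) =
      (\<lambda>(i, P). level_block n i 0 P) ` (Zn 3 \<times> two_subsets (Zn n)) \<union>
      (\<lambda>(i, P). level_block n i 1 P) ` (Zn 3 \<times> shifted_pairs n lt)"
    unfolding labels_def by force
  moreover have "{{(a, 0), (a, 1), (a, 2)} | a. a \<in> Zn n} = column ` Zn n"
    by (auto simp: column_def)
  ultimately show ?thesis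
    unfolding blocks_def 1 2 by simp
qed

section \<open>Number of blocks\<close>

lemma finite_labels: "finite (labels n lt)"
  unfolding labels_def using finite_subset[OF shifted_pairs_subset]
  by (simp add: finite_two_subsets finite_Zn)

lemma card_labels:
  "card (labels n lt) = (n choose 2) + card (shifted_pairs n lt)"
proof -
  have "card (two_subsets (Zn n)) = n choose 2"
    unfolding two_subsets_def by (simp add: n_subsets finite_Zn card_Zn)
  moreover have "finite (shifted_pairs n lt)"
    using finite_subset[OF shifted_pairs_subset] by (simp add: finite_two_subsets finite_Zn)
  ultimately show ?thesis
    unfolding labels_def
    by (subst card_Un_disjoint) (auto simp: card_cartesian_product finite_two_subsets finite_Zn)
qed

lemma card_blocks:
  assumes "n > 1" "odd n" and "strict_total_order_on (Zn n) lt"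
  shows "card (blocks n lt) = 3 * ((n choose 2) + card (shifted_pairs n lt)) + n"
proof -
  have "inj_on (\<lambda>(i, e, P). level_block n i e P) (Zn 3 \<times> labels n lt)"
  proof (rule inj_onI)
    fix p q
    assume pq: "p \<in> Zn 3 \<times> labels n lt" "q \<in> Zn 3 \<times> labels n lt"
      "(\<lambda>(i, e, P). level_block n i e P) p = (\<lambda>(i, e, P). level_block n i e P) q"
    obtain i e P j f Q where p: "p = (i, e, P)" and q: "q = (j, f, Q)"
      by (metis surj_pair)
    have *: "i \<in> Zn 3" "(e, P) \<in> labels n lt" "j \<in> Zn 3" "(f, Q) \<in> labels n lt"
      "level_block n i e P = level_block n j f Q"
      using pq unfolding p q by simp_all
    have "i = j \<and> e = f \<and> P = Q"
      by (rule level_block_inject[OF assms(2,1) *(1,3) labels_cases(2)[OF *(2)]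
            labels_cases(2)[OF *(4)] labels_cases(1)[OF *(2)] labels_cases(1)[OF *(4)] *(5)])
    then show "p = q"
      unfolding p q by simp
  qed
  moreover have "inj_on column (Zn n)"
    by (rule inj_onI) (auto simp: column_def doubleton_eq_iff)
  moreover have "(\<lambda>(i, e, P). level_block n i e P) ` (Zn 3 \<times> labels n lt) \<inter> column ` Zn n = {}"
    using column_neq_level_block by fastforce
  ultimately show ?thesis
    unfolding blocks_eq[OF assms(1,3)]
    by (subst card_Un_disjoint)
      (auto simp: card_image card_cartesian_product card_labels card_Zn finite_Zn finite_labels)
qed

text \<open>The claimed number equals \<open>6 * (n choose 2) + n\<close>, which is the count in
  which all 2-subsets occur with shift 1. A subset of a finite set with the same cardinality is the
  whole set, so the number is attained only then.\<close>

lemma card_blocks_iff: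
  assumes "n > 1" "odd n" and "strict_total_order_on (Zn n) lt"
  shows "card (blocks n lt) = 3 * n\<^sup>2 - 2 * n \<longleftrightarrow> no_pair_omitted n lt"
proof -
  have "2 * (n choose 2) = n * (n - 1)"
    by (cases n) (simp_all add: choose_two)
  then have "3 * n\<^sup>2 - 2 * n = 6 * (n choose 2) + n"
    using assms(1) by (cases n) (auto simp: power2_eq_square algebra_simps)
  then have "card (blocks n lt) = 3 * n\<^sup>2 - 2 * n \<longleftrightarrow> card (shifted_pairs n lt) = n choose 2"
    unfolding card_blocks[OF assms] by auto
  also have "\<dots> \<longleftrightarrow> card (shifted_pairs n lt) = card (two_subsets (Zn n))"
    unfolding two_subsets_def by (simp add: n_subsets finite_Zn card_Zn)
  also have "\<dots> \<longleftrightarrow> shifted_pairs n lt = two_subsets (Zn n)"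
    using card_subset_eq[OF finite_two_subsets[OF finite_Zn] shifted_pairs_subset] by metis
  finally show ?thesis
    unfolding shifted_pairs_eq_iff .
qed

section \<open>Block sizes and pair indices\<close>

lemma incidence_structure_blocks:
  assumes "n > 1" and "strict_total_order_on (Zn n) lt"
  shows "incidence_structure (Zn n \<times> Zn 3) (blocks n lt) (3 * n) 3"
proof -
  have "level_block n i e P \<subseteq> Zn n \<times> Zn 3 \<and> card (level_block n i e P) = 3"
    if i: "i \<in> Zn 3" and P: "P \<in> two_subsets (Zn n)" for i e P
  proof -
    have "finite P" "card P = 2" "P \<subseteq> Zn n"
      using P by (auto simp: two_subsets_def card_ge_0_finite)
    moreover have "(i + 1) mod 3 \<noteq> i" "(i + 1) mod 3 \<in> Zn 3"
      using i by (auto simp: Zn_3)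
    ultimately show ?thesis
      using i \<open>n > 1\<close> by (auto simp: level_block_def card_cartesian_product half_in_Zn)
  qed
  moreover have "column a \<subseteq> Zn n \<times> Zn 3 \<and> card (column a) = 3" if "a \<in> Zn n" for a
    using that by (auto simp: column_def Zn_3)
  ultimately have "A \<subseteq> Zn n \<times> Zn 3 \<and> card A = 3" if "A \<in> blocks n lt" for A
    using that unfolding blocks_eq[OF assms] by (fast dest: labels_cases(2))
  then show ?thesis
    unfolding incidence_structure_def
    by (simp add: card_cartesian_product card_Zn finite_Zn)
qed

text \<open>Serves to bound pair indices: \<open>a\<close> is a block known to contain the two
  points, and \<open>b\<close> is the only other candidate.\<close>

lemma card_subset_doubleton:
  assumes "a \<in> S" "S \<subseteq> {a, b}"
  shows "card S \<in> {1, 2}"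
proof -
  have "S = {a} \<or> S = {a, b}"
    using assms by blast
  then show ?thesis
    by (cases "a = b") auto
qed

lemma pair_index_same_level:
  assumes "n > 1" "odd n" and order: "strict_total_order_on (Zn n) lt"
    and i: "i \<in> Zn 3" and xy: "x \<in> Zn n" "y \<in> Zn n" "x \<noteq> y"
  shows "pair_index (blocks n lt) (x, i) (y, i) \<in> {1, 2}"
proof -
  let ?S = "{A \<in> blocks n lt. (x, i) \<in> A \<and> (y, i) \<in> A}"
  have P: "{x, y} \<in> two_subsets (Zn n)"
    using xy by (rule two_subsetsI)
  have "level_block n i 0 {x, y} \<in> ?S"
    unfolding blocks_eq[OF assms(1,3)] using P i
    by (auto simp: labels_def mem_level_block intro!: image_eqI[of _ _ "(i, 0, {x, y})"])
  moreover have "?S \<subseteq> {level_block n i 0 {x, y}, level_block n i 1 {x, y}}"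
  proof
    fix A assume A: "A \<in> ?S"
    \<comment> \<open>A column has only one point on each level.\<close>
    then have "A \<notin> range column"
      using xy by (auto simp: column_def)
    with A obtain j e Q where jeQ: "j \<in> Zn 3" "(e, Q) \<in> labels n lt" "A = level_block n j e Q"
      unfolding blocks_eq[OF assms(1,3)] by auto
    note Q = labels_cases[OF jeQ(2)]
    \<comment> \<open>A block of another level has at most one point on level \<open>i\<close>, and
      so does the midpoint part of any block; hence both points come from \<open>Q\<close>.\<close>
    have "j = i" "x \<in> Q" "y \<in> Q"
      using A jeQ(1,3) xy by (auto simp: mem_level_block Zn_3)
    then show "A \<in> {level_block n i 0 {x, y}, level_block n i 1 {x, y}}"
      using Q jeQ(3) two_subsets_doubleton_eq[OF Q(2) _ _ xy(3)] by auto
  qed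
  ultimately show ?thesis
    unfolding pair_index_def by (rule card_subset_doubleton)
qed

text \<open>If \<open>{x, z}\<close> with shift \<open>e\<close> has midpoint \<open>y\<close>, then
  \<open>x + z + e = 2 * y\<close> modulo \<open>n\<close>, so \<open>z\<close> must be
  \<open>c e\<close>. This gives a block only if \<open>c e\<close> differs from \<open>x\<close>
  and the resulting pair is a label.\<close>

lemma blocks_through_next_level:
  assumes "n > 1" "odd n" and order: "strict_total_order_on (Zn n) lt"
    and i: "i \<in> Zn 3" and xy: "x \<in> Zn n" "y \<in> Zn n"
  defines "c \<equiv> \<lambda>e. (2 * y - x - e) mod int n"
  shows "{A \<in> blocks n lt. (x, i) \<in> A \<and> (y, (i + 1) mod 3) \<in> A} =
    {level_block n i e {x, c e} | e. x \<noteq> c e \<and> (e, {x, c e}) \<in> labels n lt} \<union>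
    (if x = y then {column x} else {})" (is "?S = ?T \<union> ?C")
proof -
  have c: "c e \<in> Zn n" for e
    using \<open>n > 1\<close> by (simp add: c_def mod_in_Zn)
  have c_cong: "[z = c e] (mod int n) \<longleftrightarrow> [x + z + e = 2 * y] (mod int n)" for z e
  proof -
    have "[z = c e] (mod int n) \<longleftrightarrow> [z = 2 * y - x - e] (mod int n)"
      by (simp add: c_def cong_def)
    also have "\<dots> \<longleftrightarrow> [x + z + e = 2 * y] (mod int n)"
      by (simp add: cong_iff_dvd_diff algebra_simps)
    finally show ?thesis .
  qed
  have half_iff: "half n (x + z + e) = y \<longleftrightarrow> z = c e" if "z \<in> Zn n" for z e
    using half_eq_Zn_iff[OF assms(2) xy(2)] c_cong[of z e] Zn_eq_iff[OF that c] by simp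
  have succ: "(i + 1) mod 3 \<noteq> i"
    using i by (auto simp: Zn_3)
  have sub: "?T \<union> ?C \<subseteq> ?S"
  proof -
    have "?T \<subseteq> ?S"
    proof clarify
      fix e assume e: "x \<noteq> c e" "(e, {x, c e}) \<in> labels n lt"
      have "level_block n i e {x, c e} \<in> blocks n lt"
        unfolding blocks_eq[OF assms(1,3)] using e i by force
      moreover have "half n (x + c e + e) = y"
        using half_iff[OF c] by simp
      ultimately show "level_block n i e {x, c e} \<in> blocks n lt \<and> (x, i) \<in> level_block n i e {x, c e}
          \<and> (y, (i + 1) mod 3) \<in> level_block n i e {x, c e}"
        using e by (auto simp: mem_level_block)
    qed
    moreover have "column x \<in> ?S" if "x = y"
      unfolding blocks_eq[OF assms(1,3)] using that xy i by (auto simp: column_def Zn_3)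
    ultimately show ?thesis by auto
  qed
  have "?S \<subseteq> ?T \<union> ?C"
  proof
    fix A assume A: "A \<in> ?S"
    then consider (col) a where "A = column a"
      | (lev) j e Q where "j \<in> Zn 3" "(e, Q) \<in> labels n lt" "A = level_block n j e Q"
      unfolding blocks_eq[OF assms(1,3)] by auto
    then show "A \<in> ?T \<union> ?C"
    proof cases
      case col
      with A show ?thesis by (auto simp: column_def)
    next
      case lev
      note Q = labels_cases[OF lev(2)]
      \<comment> \<open>The levels \<open>i\<close> and \<open>i + 1\<close> are both met only by a
        block of level \<open>i\<close>: one of level \<open>i + 1\<close> misses level
        \<open>i\<close>, and one of level \<open>i + 2\<close> misses level
        \<open>i + 1\<close>.\<close>
      have mem: "j = i" "x \<in> Q" "half n (\<Sum>Q + e) = y"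
        using A lev(1,3) i by (auto simp: mem_level_block Zn_3)
      obtain z where z: "Q = {x, z}" "z \<in> Zn n" "x \<noteq> z"
        using Q(2) mem(2) by (auto elim!: two_subsetsE)
      have "z = c e"
        using half_iff[OF z(2)] mem(3) z by simp
      then show ?thesis
        using lev mem z by blast
    qed
  qed
  with sub show ?thesis by blast
qed

text \<open>The second and third conclusions single out pairs of index 2 and of index 1, which rule
  out a 2-design.\<close>

lemma pair_index_next_level:
  assumes "n > 1" "odd n" and order: "strict_total_order_on (Zn n) lt"
    and i: "i \<in> Zn 3" and xy: "x \<in> Zn n" "y \<in> Zn n"
  shows "pair_index (blocks n lt) (x, i) (y, (i + 1) mod 3) \<in> {1, 2}"
    and "x = y \<Longrightarrow> pair_index (blocks n lt) (x, i) (y, (i + 1) mod 3) = 2"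
    and "[2 * (y - x) = 1] (mod int n) \<Longrightarrow>
      pair_index (blocks n lt) (x, i) (y, (i + 1) mod 3) = 1"
proof -
  define c where "c = (\<lambda>e. (2 * y - x - e) mod int n)"
  let ?S = "{A \<in> blocks n lt. (x, i) \<in> A \<and> (y, (i + 1) mod 3) \<in> A}"
  let ?B = "\<lambda>e. level_block n i e {x, c e}"
  have S: "?S = {?B e | e. x \<noteq> c e \<and> (e, {x, c e}) \<in> labels n lt} \<union>
      (if x = y then {column x} else {})"
    unfolding c_def by (rule blocks_through_next_level[OF assms])
  have c: "c e \<in> Zn n" for e
    using \<open>n > 1\<close> by (simp add: c_def mod_in_Zn)
  \<comment> \<open>This congruence describes when shift \<open>e\<close> degenerates, the second
    element of the pair coinciding with \<open>x\<close>. For \<open>e = 0\<close> it means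
    \<open>x = y\<close>; for \<open>e = 1\<close> it is the hypothesis of the third
    conclusion.\<close>
  have c_eq: "x = c e \<longleftrightarrow> [2 * (y - x) = e] (mod int n)" for e
  proof -
    have "x = c e \<longleftrightarrow> [x = 2 * y - x - e] (mod int n)"
      using Zn_eq_iff[OF xy(1) c] by (simp add: c_def cong_def)
    also have "\<dots> \<longleftrightarrow> [2 * (y - x) = e] (mod int n)"
      by (subst cong_sym_eq) (simp add: cong_iff_dvd_diff algebra_simps)
    finally show ?thesis .
  qed
  have "coprime 2 (int n)" using assms(2) by simp
  then have c0: "x = c 0 \<longleftrightarrow> x = y"
    using cong_mult_lcancel[of 2 "int n" "y - x" 0] Zn_eq_iff[OF xy(2,1)] c_eq[of 0]
    by (auto simp: cong_diff_iff_cong_0)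
  have lab0: "(0, {x, c 0}) \<in> labels n lt" if "x \<noteq> y"
    using that c0 two_subsetsI[OF xy(1) c] by (simp add: labels_def)
  have lab: "e \<in> {0, 1}" if "(e, {x, c e}) \<in> labels n lt" for e
    using labels_cases(1)[OF that] .
  have eq: "?S = {column x, ?B 1}" if "x = y"
  proof -
    have "x \<noteq> c 1"
      using that c_eq[of 1] \<open>n > 1\<close> by (simp add: cong_def)
    \<comment> \<open>For \<open>x = y\<close> the element \<open>c 1\<close> is
      \<open>x - 1\<close>, with successor \<open>x\<close>; irreflexivity alone then puts
      \<open>{x, c 1}\<close> among the shifted pairs, whatever the order.\<close>
    moreover have "(c 1 + 1) mod int n = x"
      using that xy by (simp add: c_def mod_add_left_eq Zn_def)
    then have "\<not> lt x ((c 1 + 1) mod int n)"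
      using order xy by (simp add: strict_total_order_on_def irreflp_on_def)
    ultimately have "{x, c 1} \<in> shifted_pairs n lt"
      unfolding shifted_pairs_def using xy c by blast
    then have "(1, {x, c 1}) \<in> labels n lt"
      by (simp add: labels_def)
    then show ?thesis
      unfolding S using that c0 lab \<open>x \<noteq> c 1\<close> by auto
  qed
  then show two: "pair_index (blocks n lt) (x, i) (y, (i + 1) mod 3) = 2" if "x = y"
    unfolding pair_index_def eq[OF that]
    using column_neq_level_block[OF i] by (simp add: card_insert_if)
  \<comment> \<open>The second alternative records \<open>x \<noteq> c 1\<close> so that it can be
    excluded when shift 1 degenerates.\<close>
  have neq: "?S = {?B 0} \<or> x \<noteq> c 1 \<and> ?S = {?B 0, ?B 1}" if "x \<noteq> y"
  proof (cases "x \<noteq> c 1 \<and> (1, {x, c 1}) \<in> labels n lt")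
    case True
    then have "?S = {?B 0, ?B 1}"
      unfolding S using that c0 lab0[OF that] lab by auto
    with True show ?thesis by simp
  next
    case False
    then have "?S = {?B 0}"
      unfolding S using that c0 lab0[OF that] lab by fastforce
    then show ?thesis ..
  qed
  show "pair_index (blocks n lt) (x, i) (y, (i + 1) mod 3) \<in> {1, 2}"
  proof (cases "x = y")
    case True
    then show ?thesis using two by simp
  next
    case False
    then show ?thesis
      unfolding pair_index_def using neq[OF False]
      by (intro card_subset_doubleton[of "?B 0" _ "?B 1"]) blast+
  qed
  show "pair_index (blocks n lt) (x, i) (y, (i + 1) mod 3) = 1"
    if *: "[2 * (y - x) = 1] (mod int n)"
  proof -
    have "x \<noteq> y"
      using * \<open>n > 1\<close> by (auto simp: cong_def)
    then show ?thesis
      unfolding pair_index_def using neq * c_eq[of 1] by (metis is_singletonI is_singleton_altdef)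
  qed
qed

section \<open>The adesign property and the usual order\<close>

lemma pair_index_commute: "pair_index \<B> x y = pair_index \<B> y x"
  unfolding pair_index_def by (simp add: conj_commute)

lemma pair_index_blocks:
  assumes "n > 1" "odd n" "strict_total_order_on (Zn n) lt"
    and "p \<in> Zn n \<times> Zn 3" "q \<in> Zn n \<times> Zn 3" "p \<noteq> q"
  shows "pair_index (blocks n lt) p q \<in> {1, 2}"
proof -
  obtain x i y j where pq: "p = (x, i)" "q = (y, j)"
    by (metis surj_pair)
  have mem: "x \<in> Zn n" "i \<in> Zn 3" "y \<in> Zn n" "j \<in> Zn 3"
    using assms(4,5) pq by auto
  \<comment> \<open>Distinct elements of \<open>Zn 3\<close> are consecutive in one direction or the
    other, and the pair index is symmetric.\<close>
  then consider "j = i" | "j = (i + 1) mod 3" | "i = (j + 1) mod 3"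
    by (fastforce simp: Zn_3)
  then show ?thesis
  proof cases
    case 1
    then show ?thesis
      using pair_index_same_level[OF assms(1-3) mem(2,1,3)] assms(6) pq by simp
  next
    case 2
    then show ?thesis
      using pair_index_next_level(1)[OF assms(1-3) mem(2,1,3)] pq by simp
  next
    case 3
    then show ?thesis
      using pair_index_next_level(1)[OF assms(1-3) mem(4,3,1)] pq by (simp add: pair_index_commute)
  qed
qed

lemma not_two_design_blocks:
  assumes "n > 1" "odd n" "strict_total_order_on (Zn n) lt"
  shows "\<not> two_design (Zn n \<times> Zn 3) (blocks n lt) v k \<mu>"
proof
  assume "two_design (Zn n \<times> Zn 3) (blocks n lt) v k \<mu>"
  then have const: "pair_index (blocks n lt) p q = \<mu>"
    if "p \<in> Zn n \<times> Zn 3" "q \<in> Zn n \<times> Zn 3" "p \<noteq> q" for p q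
    using that unfolding two_design_def by blast
  have mem: "0 \<in> Zn 3" "(0 + 1) mod 3 \<in> Zn 3" "0 \<in> Zn n" "half n 1 \<in> Zn n"
    using assms(1) by (auto simp: Zn_3 half_in_Zn) (simp add: Zn_def)
  have "pair_index (blocks n lt) (0, 0) (0, (0 + 1) mod 3) = 2"
    using pair_index_next_level(2)[OF assms mem(1,3,3)] by simp
  \<comment> \<open>The witness \<open>half n 1\<close> is the inverse of 2, so it solves
    \<open>2 * (y - x) = 1\<close> for \<open>x = 0\<close>.\<close>
  moreover have "pair_index (blocks n lt) (0, 0) (half n 1, (0 + 1) mod 3) = 1"
    using pair_index_next_level(3)[OF assms mem(1,3,4)] two_half_cong[OF assms(2)] by simp
  ultimately show False
    using const[of "(0, 0)" "(0, (0 + 1) mod 3)"] const[of "(0, 0)" "(half n 1, (0 + 1) mod 3)"] mem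
    by simp
qed

text \<open>For \<open>x < y\<close> the successor \<open>x + 1\<close> is at most \<open>y\<close>,
  hence does not wrap around, and \<open>y\<close> is not below it.\<close>

lemma no_pair_omitted_less:
  assumes "\<forall>a\<in>Zn n. \<forall>b\<in>Zn n. lt a b \<longleftrightarrow> a < b"
  shows "no_pair_omitted n lt"
proof -
  have "\<not> lt y ((x + 1) mod int n)" if "x \<in> Zn n" "y \<in> Zn n" "x < y" for x y
  proof -
    have "(x + 1) mod int n = x + 1" "x + 1 \<in> Zn n"
      using that by (auto simp: Zn_def)
    then show ?thesis
      using assms that by simp
  qed
  then show ?thesis
    unfolding no_pair_omitted_def by (metis linorder_neqE)
qed

theorem theorem5:
  fixes n :: nat and lt :: "int \<Rightarrow> int \<Rightarrow> bool"
  assumes "n > 3" and "odd n" and "strict_total_order_on (Zn n) lt"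
  shows "two_adesign (Zn n \<times> Zn 3) (blocks n lt) (3 * n) 3 1
    \<and> (card (blocks n lt) = 3 * n\<^sup>2 - 2 * n \<longleftrightarrow> no_pair_omitted n lt)
    \<and> ((\<forall>a\<in>Zn n. \<forall>b\<in>Zn n. lt a b \<longleftrightarrow> a < b) \<longrightarrow> card (blocks n lt) = 3 * n\<^sup>2 - 2 * n)"
proof -
  have n: "n > 1" using assms(1) by simp
  note design = n assms(2,3)
  have "two_adesign (Zn n \<times> Zn 3) (blocks n lt) (3 * n) 3 1"
    \<comment> \<open>Rewriting \<open>1 + 1\<close> turns the required set
      \<open>{l, l + 1}\<close> into \<open>{1, 2}\<close>.\<close>
    unfolding two_adesign_def one_add_one
    using incidence_structure_blocks[OF n assms(3)] pair_index_blocks[OF design]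
      not_two_design_blocks[OF design] by (intro conjI ballI impI zero_less_one) blast+
  then show ?thesis
    using card_blocks_iff[OF design] no_pair_omitted_less by blast
qed

end
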